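(* Let $\mathcal{H}$ be an infinite dimensional complex Hilbert space and let $T\in\mathcal{B}(\mathcal{H})$ be a $\lambda$-hyponormal operator for some $0<\lambda\leq 1$. Then $T$ is not weakly hypercyclic.
   Context: $\mathcal{B}(\mathcal{H})$ is the algebra of all bounded linear operators on $\mathcal{H}$. For $\lambda>0$, an operator $T\in\mathcal{B}(\mathcal{H})$ is called $\lambda$-hyponormal if $T^*T\geq \frac{1}{\lambda}TT^*$ (in the order of self-adjoint operators). For $x\in\mathcal{H}$, $Orb(T,x)=\{T^n x: n\geq 0\}$. The operator $T$ is weakly hypercyclic if there is $x\in\mathcal{H}$ such that $Orb(T,x)$ is dense in $\mathcal{H}$ with respect to the weak topology. *)

theory Defs
  imports "HOL-Analysis.Analysis"
begin

class complex_vector = real_vector +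
  fixes scaleC :: "complex \<Rightarrow> 'a \<Rightarrow> 'a" (infixr "*\<^sub>C" 75)
  assumes scaleC_add_right: "a *\<^sub>C (x + y) = a *\<^sub>C x + a *\<^sub>C y"
    and scaleC_add_left: "(a + b) *\<^sub>C x = a *\<^sub>C x + b *\<^sub>C x"
    and scaleC_scaleC: "a *\<^sub>C b *\<^sub>C x = (a * b) *\<^sub>C x"
    and scaleC_of_real: "complex_of_real r *\<^sub>C x = r *\<^sub>R x"

(* Linear in the first argument.  The inherited real inner product is tied to the real part
   of the complex one, so the norm is norm x = sqrt (Re (cinner x x)) and positive
   definiteness is inherited from real_inner (see norm_eq_sqrt_cinner, cinner_nonneg,
   cinner_eq_zero_iff below). *)
class complex_inner = complex_vector + real_inner +
  fixes cinner :: "'a \<Rightarrow> 'a \<Rightarrow> complex"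
  assumes cinner_commute: "cinner x y = cnj (cinner y x)"
    and cinner_add_left: "cinner (x + y) z = cinner x z + cinner y z"
    and cinner_scaleC_left: "cinner (a *\<^sub>C x) y = a * cinner x y"
    and inner_eq_Re_cinner: "inner x y = Re (cinner x y)"

class complex_hilbert_space = complex_inner + complete_space

instantiation complex :: complex_hilbert_space
begin

definition scaleC_complex :: "complex \<Rightarrow> complex \<Rightarrow> complex"
  where "scaleC_complex a x = a * x"

definition cinner_complex :: "complex \<Rightarrow> complex \<Rightarrow> complex"
  where "cinner_complex x y = x * cnj y"

instance
  by standard
    (auto simp: scaleC_complex_def cinner_complex_def algebra_simps scaleR_conv_of_real
      inner_complex_def)

end

lemma vector_space_scaleC: "vector_space (scaleC :: complex \<Rightarrow> 'a::complex_vector \<Rightarrow> 'a)"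
  using scaleC_of_real[of 1]
  by unfold_locales (simp_all add: scaleC_add_right scaleC_add_left scaleC_scaleC)

definition infinite_dim :: "'a::complex_vector itself \<Rightarrow> bool"
  where "infinite_dim _ \<longleftrightarrow>
    \<not> (\<exists>B :: 'a set. finite B \<and> module.span scaleC B = UNIV)"

definition bounded_clinear ::
    "('a::{complex_vector, real_normed_vector} \<Rightarrow> 'b::{complex_vector, real_normed_vector}) \<Rightarrow> bool"
  where "bounded_clinear T \<longleftrightarrow>
    bounded_linear T \<and> (\<forall>c x. T (c *\<^sub>C x) = c *\<^sub>C T x)"

(* Well defined for bounded operators on a Hilbert space by ex1_cadjoint below. *)
definition cadjoint :: "('a::complex_hilbert_space \<Rightarrow> 'a) \<Rightarrow> 'a \<Rightarrow> 'a"
  where "cadjoint T = (THE S. \<forall>x y. cinner (T x) y = cinner x (S y))"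

definition op_positive :: "('a::complex_inner \<Rightarrow> 'a) \<Rightarrow> bool"
  where "op_positive A \<longleftrightarrow> (\<forall>x. cinner (A x) x \<in> \<real>\<^sub>\<ge>\<^sub>0)"

definition op_le :: "('a::complex_inner \<Rightarrow> 'a) \<Rightarrow> ('a \<Rightarrow> 'a) \<Rightarrow> bool"
  where "op_le A B \<longleftrightarrow> op_positive (\<lambda>x. B x - A x)"

definition lambda_hyponormal :: "real \<Rightarrow> ('a::complex_hilbert_space \<Rightarrow> 'a) \<Rightarrow> bool"
  where "lambda_hyponormal l T \<longleftrightarrow>
    op_le (\<lambda>x. (1 / l) *\<^sub>R T (cadjoint T x)) (\<lambda>x. cadjoint T (T x))"

definition weak_topology :: "'a::{complex_vector, real_normed_vector} topology"
  where "weak_topology =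
    topology_generated_by {f -` U | (f :: 'a \<Rightarrow> complex) U. bounded_clinear f \<and> open U}"

definition Orb :: "('a \<Rightarrow> 'a) \<Rightarrow> 'a \<Rightarrow> 'a set"
  where "Orb T x = {(T ^^ n) x | n. n \<ge> 0}"

definition weakly_hypercyclic :: "('a::{complex_vector, real_normed_vector} \<Rightarrow> 'a) \<Rightarrow> bool"
  where "weakly_hypercyclic T \<longleftrightarrow> (\<exists>x. weak_topology closure_of Orb T x = UNIV)"


lemma cinner_self: "cinner x x = complex_of_real ((norm x)\<^sup>2)" for x :: "'a::complex_inner"
proof (rule complex_eqI)
  show "Re (cinner x x) = Re (complex_of_real ((norm x)\<^sup>2))"
    by (simp add: power2_norm_eq_inner inner_eq_Re_cinner flip: of_real_power)
  show "Im (cinner x x) = Im (complex_of_real ((norm x)\<^sup>2))"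
    using arg_cong[OF cinner_commute[of x x], of Im] by simp
qed

lemma norm_eq_sqrt_cinner: "norm x = sqrt (Re (cinner x x))" for x :: "'a::complex_inner"
  by (simp add: norm_eq_sqrt_inner inner_eq_Re_cinner)

lemma cinner_nonneg: "cinner x x \<in> \<real>\<^sub>\<ge>\<^sub>0" for x :: "'a::complex_inner"
  unfolding cinner_self by (simp add: complex_nonneg_Reals_iff flip: of_real_power)

lemma cinner_eq_zero_iff: "cinner x x = 0 \<longleftrightarrow> x = 0" for x :: "'a::complex_inner"
  by (simp add: cinner_self)

lemma topspace_weak_topology: "topspace weak_topology = UNIV"
proof -
  have "bounded_clinear (\<lambda>_::'a. 0::complex)"
    by (simp add: bounded_clinear_def scaleC_complex_def)
  then have "UNIV \<in> {f -` U | (f :: 'a \<Rightarrow> complex) U. bounded_clinear f \<and> open U}"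
    by (auto intro!: exI[of _ "\<lambda>_. 0"] exI[of _ UNIV])
  then show ?thesis
    unfolding weak_topology_def topology_generated_by_topspace by blast
qed

lemma real_riesz:
  fixes g :: "'a::{real_inner, complete_space} \<Rightarrow> real"
  assumes "bounded_linear g"
  shows "\<exists>y. \<forall>x. g x = inner x y"
proof -
  interpret g: bounded_linear g by fact
  define J where "J u = inner u u - 2 * g u" for u
  obtain K where K: "\<And>x. norm (g x) \<le> norm x * K" using g.bounded by blast
  have lb: "- (K\<^sup>2) \<le> J u" for u
  proof -
    have "g u \<le> norm u * K" using K[of u] by simp
    moreover have "0 \<le> (norm u - K)\<^sup>2" by simp
    ultimately show ?thesis
      by (simp add: J_def power2_norm_eq_inner[symmetric] power2_diff)
  qed
  have bdd: "bdd_below (range J)" using lb by (auto simp: bdd_below_def)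
  define m where "m = Inf (range J)"
  have m_le: "m \<le> J u" for u unfolding m_def using bdd by (simp add: cINF_lower)
  have "\<exists>v. J v < m + inverse (real (Suc n))" for n
    using cInf_lessD[of "range J" "m + inverse (real (Suc n))"] by (auto simp: m_def)
  then obtain u where u: "\<And>n. J (u n) < m + inverse (real (Suc n))" by metis
  have par: "J a + J b - 2 * J ((1/2) *\<^sub>R (a + b)) = (norm (a - b))\<^sup>2 / 2" for a b
    by (simp add: J_def power2_norm_eq_inner g.add g.scaleR inner_add inner_diff
        inner_commute algebra_simps)
  have dist_le: "(norm (u i - u j))\<^sup>2 \<le> 2 * (inverse (real (Suc i)) + inverse (real (Suc j)))" for i j
  proof -
    have arith: "d \<le> 2 * (p + q)" if "x + y - 2 * z = d / 2" "x < m + p" "y < m + q" "m \<le> z"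
      for x y z d p q :: real
      using that by (simp add: field_simps)
    show ?thesis by (rule arith[OF par u u m_le])
  qed
  have "Cauchy u"
  proof (rule metric_CauchyI)
    fix e :: real assume e: "e > 0"
    obtain N where N: "inverse (real (Suc N)) < e\<^sup>2 / 4"
      using reals_Archimedean[of "e\<^sup>2 / 4"] e by auto
    show "\<exists>M. \<forall>i\<ge>M. \<forall>j\<ge>M. dist (u i) (u j) < e"
    proof (intro exI allI impI)
      fix i j assume "i \<ge> N" "j \<ge> N"
      then have "inverse (real (Suc i)) \<le> inverse (real (Suc N))"
        "inverse (real (Suc j)) \<le> inverse (real (Suc N))" by simp_all
      then have "(norm (u i - u j))\<^sup>2 < e\<^sup>2" using dist_le[of i j] N by argo
      then show "dist (u i) (u j) < e" using e by (simp add: dist_norm power2_less_imp_less)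
    qed
  qed
  then obtain y where y: "u \<longlonglongrightarrow> y" using Cauchy_convergent_iff convergent_def by blast
  have "(\<lambda>n. J (u n)) \<longlonglongrightarrow> J y"
    unfolding J_def by (intro tendsto_intros y g.tendsto)
  moreover have "(\<lambda>n. m + inverse (real (Suc n))) \<longlonglongrightarrow> m + 0"
    by (intro tendsto_intros LIMSEQ_inverse_real_of_nat)
  ultimately have "J y \<le> m + 0"
    by (rule LIMSEQ_le) (intro exI allI impI less_imp_le u)
  then have Jy: "J y \<le> m" by simp
  have "g x = inner x y" for x
  proof (cases "x = 0")
    case True then show ?thesis by (simp add: g.zero)
  next
    case False
    define a where "a = inner x y - g x"
    define b where "b = inner x x"
    have b: "b > 0" using False by (simp add: b_def)
    have expand: "J (y + t *\<^sub>R x) = J y + 2 * t * a + t\<^sup>2 * b" for t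
      by (simp add: J_def a_def b_def g.add g.scaleR inner_add_left inner_add_right
          inner_commute[of y x] algebra_simps power2_eq_square)
    have "J y \<le> J (y + (- a / b) *\<^sub>R x)" by (rule order_trans[OF Jy m_le])
    also have "\<dots> = J y + 2 * (- a / b) * a + (- a / b)\<^sup>2 * b" by (rule expand)
    also have "\<dots> = J y - a\<^sup>2 / b" using b by (simp add: field_simps power2_eq_square)
    finally have "a\<^sup>2 \<le> 0" using b by (simp add: divide_le_0_iff)
    then show ?thesis by (simp add: a_def)
  qed
  then show ?thesis by blast
qed

lemma ex1_cadjoint:
  fixes T :: "'a::complex_hilbert_space \<Rightarrow> 'a"
  assumes "bounded_clinear T"
  shows "\<exists>!S. \<forall>x y. cinner (T x) y = cinner x (S y)"
proof -
  have T: "bounded_linear T" and TC: "\<And>c x. T (c *\<^sub>C x) = c *\<^sub>C T x"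
    using assms by (auto simp: bounded_clinear_def)
  have "\<exists>z. \<forall>x. inner (T x) y = inner x z" for y
    by (intro real_riesz bounded_linear_compose[OF bounded_linear_inner_left T, unfolded o_def])
  then obtain S where S: "\<And>x y. inner (T x) y = inner x (S y)" by metis
  have Im: "Im (cinner a b) = - Re (cinner (\<i> *\<^sub>C a) b)" for a b :: 'a
    by (simp add: cinner_scaleC_left)
  have adj: "cinner (T x) y = cinner x (S y)" for x y
  proof (rule complex_eqI)
    show "Re (cinner (T x) y) = Re (cinner x (S y))" using S by (simp add: inner_eq_Re_cinner)
    show "Im (cinner (T x) y) = Im (cinner x (S y))"
      using S[of "\<i> *\<^sub>C x" y] unfolding Im by (simp add: TC inner_eq_Re_cinner)
  qed
  show ?thesis
  proof (rule ex1I[of _ S])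
    show "\<forall>x y. cinner (T x) y = cinner x (S y)" using adj by blast
    fix R assume R: "\<forall>x y. cinner (T x) y = cinner x (R y)"
    show "R = S"
    proof
      fix y
      have "inner x (R y) = inner x (S y)" for x
        by (simp add: inner_eq_Re_cinner flip: R[rule_format] adj)
      then show "R y = S y" using vector_eq_ldot by blast
    qed
  qed
qed

lemma cinner_cadjoint:
  assumes "bounded_clinear T"
  shows "cinner (T x) y = cinner x (cadjoint T y)"
  using theI'[OF ex1_cadjoint[OF assms]] unfolding cadjoint_def by blast

end

theory Submission
  imports Defs
begin

text \<open>
  Since \<open>l \<le> 1\<close>, the operator is hyponormal: \<open>norm (T\<^sup>* z) \<le> norm (T z)\<close>. Hence
  \<open>(norm (T z))\<^sup>2 = \<langle>z, T\<^sup>* (T z)\<rangle> \<le> norm z * norm (T (T z))\<close>, so the norms along an orbit are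
  log-convex. Two cases remain.

  If the norms along the orbit never increase, the orbit lies in a ball, and a ball cannot be
  weakly dense in a nonzero space (\<open>bounded_not_weakly_dense\<close>).

  Otherwise the norms grow at least geometrically, \<open>norm (T\<^sup>n x) \<ge> c r\<^sup>n\<close> with \<open>c > 0\<close> and
  \<open>r > 1\<close>, and then \<open>0\<close> is not in the weak closure of the orbit
  (\<open>geometric_growth_zero_not_in_weak_closure\<close>). For growth rate \<open>4\<close> a single vector \<open>y\<close> suffices
  to keep all \<open>\<bar>\<langle>x\<^sub>n, y\<rangle>\<bar>\<close> away from \<open>0\<close>; it is a series of multiples \<open>\<plusminus>4\<^sup>-\<^sup>n\<close> of the normalised
  \<open>x\<^sub>n\<close> with greedily chosen signs (\<open>inner_bounded_below_of_growth\<close>). For general \<open>r > 1\<close> choose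
  \<open>k\<close> with \<open>r\<^sup>k \<ge> 4\<close>, split the sequence into its \<open>k\<close> residue classes, and use the weak
  neighbourhood of \<open>0\<close> given by the resulting \<open>k\<close> vectors.
\<close>

section \<open>Vectors whose inner products with a fast growing sequence stay away from zero\<close>

text \<open>Partial sums of the series: the sign of the \<open>n\<close>-th term is that of the inner product of
  \<open>x n\<close> with the preceding partial sum, so that the new term cannot cancel that product.\<close>

primrec greedy_sum :: "(nat \<Rightarrow> 'a::real_inner) \<Rightarrow> nat \<Rightarrow> 'a" where
  "greedy_sum x 0 = 0"
| "greedy_sum x (Suc n) = greedy_sum x n +
     ((if inner (x n) (greedy_sum x n) \<ge> 0 then 1 else - 1) * (1/4) ^ n) *\<^sub>R sgn (x n)"

lemma greedy_sum_inner_ge: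
  "\<bar>inner (x n) (greedy_sum x (Suc n))\<bar> \<ge> (1/4) ^ n * norm (x n)"
proof -
  have "inner (x n) (sgn (x n)) = norm (x n)"
    by (cases "x n = 0")
      (simp_all add: sgn_div_norm dot_square_norm power2_eq_square)
  moreover have "0 \<le> (1/4 :: real) ^ n * norm (x n)" by simp
  ultimately show ?thesis
    by (auto simp: inner_add_right)
qed

lemma greedy_sum_dist:
  "norm (greedy_sum x (n + k) - greedy_sum x n) \<le> 4/3 * (1/4) ^ n * (1 - (1/4) ^ k)"
proof (induction k)
  case 0
  then show ?case by simp
next
  case (Suc k)
  define m where "m = n + k"
  have "norm (greedy_sum x (Suc m) - greedy_sum x m) \<le> (1/4) ^ m"
    by (simp add: norm_sgn)
  then have "norm (greedy_sum x (Suc m) - greedy_sum x n)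
      \<le> (1/4) ^ m + 4/3 * (1/4) ^ n * (1 - (1/4) ^ k)"
    using Suc.IH norm_triangle_ineq[of "greedy_sum x (Suc m) - greedy_sum x m"
        "greedy_sum x m - greedy_sum x n"]
    by (simp add: m_def del: greedy_sum.simps)
  also have "\<dots> = 4/3 * (1/4) ^ n * (1 - (1/4) ^ Suc k)"
    by (simp add: m_def power_add field_simps)
  finally show ?case by (simp add: m_def del: greedy_sum.simps)
qed

lemma convergent_greedy_sum:
  fixes x :: "nat \<Rightarrow> 'a::{real_inner, complete_space}"
  shows "convergent (greedy_sum x)"
proof -
  have close: "norm (greedy_sum x (n + k) - greedy_sum x n) \<le> 4/3 * (1/4) ^ n" for n k
    using greedy_sum_dist[of x n k] by (rule order_trans) simp
  have "Cauchy (greedy_sum x)"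
  proof (rule CauchyI')
    fix e :: real assume "e > 0"
    then obtain M where M: "(1/4) ^ M < 3/4 * e"
      using real_arch_pow_inv[of "3/4 * e" "1/4"] by auto
    show "\<exists>M. \<forall>m\<ge>M. \<forall>n>m. dist (greedy_sum x m) (greedy_sum x n) < e"
    proof (intro exI allI impI)
      fix m n :: nat assume "M \<le> m" "m < n"
      then have "(1/4 :: real) ^ m \<le> (1/4) ^ M" by (intro power_decreasing) auto
      moreover have "norm (greedy_sum x m - greedy_sum x n) \<le> 4/3 * (1/4) ^ m"
        using close[of m "n - m"] \<open>m < n\<close> by (simp add: norm_minus_commute)
      ultimately show "dist (greedy_sum x m) (greedy_sum x n) < e"
        using M unfolding dist_norm by linarith
    qed
  qed
  then show ?thesis using Cauchy_convergent_iff by blast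
qed

text \<open>The terms of the series after the \<open>n\<close>-th have total norm at most a third of the \<open>n\<close>-th, so
  they destroy at most a third of the lower bound reached at stage \<open>n\<close>.\<close>

lemma inner_bounded_below_of_growth:
  fixes x :: "nat \<Rightarrow> 'a::{real_inner, complete_space}"
  assumes growth: "\<And>n. c * 4 ^ n \<le> norm (x n)"
  shows "\<exists>y. \<forall>n. 2/3 * c \<le> \<bar>inner (x n) y\<bar>"
proof -
  obtain y where y: "greedy_sum x \<longlonglongrightarrow> y"
    using convergent_greedy_sum[of x] by (auto simp: convergent_def)
  have "2/3 * c \<le> \<bar>inner (x n) y\<bar>" for n
  proof -
    define p where "p = greedy_sum x (Suc n)"
    define b where "b = (1/4) ^ n * norm (x n)"
    have tail: "norm (greedy_sum x (k + Suc n) - p) \<le> 1/3 * (1/4) ^ n" for k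
    proof -
      have "norm (greedy_sum x (k + Suc n) - p) \<le> 4/3 * (1/4) ^ Suc n * (1 - (1/4) ^ k)"
        using greedy_sum_dist[of x "Suc n" k] unfolding p_def by (simp only: add.commute)
      also have "\<dots> \<le> 4/3 * (1/4) ^ Suc n * 1"
        by (intro mult_left_mono) auto
      finally show ?thesis by simp
    qed
    have "(\<lambda>k. norm (greedy_sum x (k + Suc n) - p)) \<longlonglongrightarrow> norm (y - p)"
      by (intro tendsto_intros LIMSEQ_ignore_initial_segment y)
    then have "norm (y - p) \<le> 1/3 * (1/4) ^ n"
      by (rule LIMSEQ_le_const2) (use tail in blast)
    then have "norm (x n) * norm (y - p) \<le> norm (x n) * (1/3 * (1/4) ^ n)"
      by (rule mult_left_mono) simp
    then have "\<bar>inner (x n) (y - p)\<bar> \<le> 1/3 * b"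
      using Cauchy_Schwarz_ineq2[of "x n" "y - p"] by (simp add: b_def mult.commute)
    moreover have "b \<le> \<bar>inner (x n) p\<bar>"
      unfolding b_def p_def by (rule greedy_sum_inner_ge)
    ultimately have "2/3 * b \<le> \<bar>inner (x n) y\<bar>"
      unfolding inner_diff_right by linarith
    moreover have "c \<le> b"
      using growth[of n] by (simp add: b_def power_divide field_simps)
    ultimately show ?thesis by simp
  qed
  then show ?thesis by blast
qed

section \<open>Weak closures of bounded and of geometrically growing sets\<close>

lemma bounded_clinear_cinner_left:
  "bounded_clinear (\<lambda>x. cinner x y)" for y :: "'a::complex_inner"
  unfolding bounded_clinear_def
proof
  have re: "Re (cinner x y) = inner x y" for x
    by (simp add: inner_eq_Re_cinner)
  have im: "Im (cinner x y) = - inner (\<i> *\<^sub>C x) y" for x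
    by (simp add: inner_eq_Re_cinner cinner_scaleC_left)
  have norm_i: "norm (\<i> *\<^sub>C x) = norm x" for x :: 'a
  proof -
    have "cinner x (\<i> *\<^sub>C x) = - \<i> * cinner x x"
      using cinner_commute[of x "\<i> *\<^sub>C x"] cinner_commute[of x x]
      by (simp add: cinner_scaleC_left)
    then show ?thesis by (simp add: norm_eq_sqrt_cinner cinner_scaleC_left)
  qed
  show "bounded_linear (\<lambda>x. cinner x y)"
  proof (rule bounded_linear_intro[where K = "2 * norm y"])
    show "cinner (r *\<^sub>R x) y = r *\<^sub>R cinner x y" for r x
      by (simp add: cinner_scaleC_left scaleR_conv_of_real flip: scaleC_of_real)
    show "norm (cinner x y) \<le> norm x * (2 * norm y)" for x
      using cmod_le[of "cinner x y"] Cauchy_Schwarz_ineq2[of x y]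
        Cauchy_Schwarz_ineq2[of "\<i> *\<^sub>C x" y]
      by (simp add: re im norm_i)
  qed (rule cinner_add_left)
qed (simp add: cinner_scaleC_left scaleC_complex_def)

lemma openin_weak_topology_inner:
  fixes y :: "'a::complex_inner"
  assumes "open U"
  shows "openin weak_topology {z. inner z y \<in> U}"
proof -
  have "{z. inner z y \<in> U} = (\<lambda>z. cinner z y) -` (Re -` U)"
    by (auto simp: inner_eq_Re_cinner)
  moreover have "open (Re -` U)"
    by (intro open_vimage assms continuous_on_Re continuous_on_id)
  ultimately show ?thesis
    unfolding weak_topology_def
    by (intro topology_generated_by_Basis) (use bounded_clinear_cinner_left in blast)
qed

lemma bounded_not_weakly_dense:
  fixes v :: "'a::complex_inner" and S :: "'a set"
  assumes "v \<noteq> 0" and bound: "\<And>z. z \<in> S \<Longrightarrow> norm z \<le> M"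
  shows "weak_topology closure_of S \<noteq> UNIV"
proof
  assume dense: "weak_topology closure_of S = UNIV"
  define w where "w = (\<bar>M\<bar> + 1) *\<^sub>R sgn v"
  have w: "norm w = \<bar>M\<bar> + 1" using \<open>v \<noteq> 0\<close> by (simp add: w_def norm_sgn)
  let ?U = "{z. inner z w \<in> {\<bar>M\<bar> * norm w <..}}"
  have "openin weak_topology ?U" by (intro openin_weak_topology_inner) simp
  moreover have "\<bar>M\<bar> * norm w < norm w * norm w"
    by (intro mult_strict_right_mono) (auto simp: w)
  then have "w \<in> ?U" by (simp add: dot_square_norm power2_eq_square)
  ultimately obtain z where z: "z \<in> S" "\<bar>M\<bar> * norm w < inner z w"
    using dense in_closure_of[of w weak_topology S] by force
  have "inner z w \<le> norm z * norm w" by (rule norm_cauchy_schwarz)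
  also have "\<dots> \<le> \<bar>M\<bar> * norm w"
    using bound[OF z(1)] by (intro mult_right_mono) auto
  finally show False using z(2) by simp
qed

lemma geometric_growth_zero_not_in_weak_closure:
  fixes x :: "nat \<Rightarrow> 'a::complex_hilbert_space"
  assumes "0 < c" "1 < r" and growth: "\<And>n. c * r ^ n \<le> norm (x n)"
  shows "0 \<notin> weak_topology closure_of range x"
proof
  assume closure: "0 \<in> weak_topology closure_of range x"
  obtain k where k: "4 < r ^ k" using real_arch_pow[OF \<open>1 < r\<close>] by blast
  have "k > 0" using k by (cases k) auto
  have "\<exists>y. \<forall>j. 2/3 * c \<le> \<bar>inner (x (j * k + i)) y\<bar>" for i
  proof (rule inner_bounded_below_of_growth)
    fix j
    have "(4::real) ^ j \<le> (r ^ k) ^ j" using k by (intro power_mono) auto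
    also have "\<dots> \<le> r ^ (j * k + i)"
      using \<open>1 < r\<close> by (simp add: power_increasing mult.commute flip: power_mult)
    finally have "c * 4 ^ j \<le> c * r ^ (j * k + i)" using \<open>0 < c\<close> by simp
    then show "c * 4 ^ j \<le> norm (x (j * k + i))" using growth order_trans by blast
  qed
  then obtain Y where Y: "\<And>i j. 2/3 * c \<le> \<bar>inner (x (j * k + i)) (Y i)\<bar>" by metis
  define N where "N i = {z. inner z (Y i) \<in> {- (2/3 * c) <..< 2/3 * c}}" for i
  have "openin weak_topology (N i)" for i
    unfolding N_def by (rule openin_weak_topology_inner) simp
  then have "openin weak_topology (\<Inter>i\<in>{..<k}. N i)"
    using \<open>k > 0\<close> by (intro openin_INT2) auto
  moreover have "0 \<in> (\<Inter>i\<in>{..<k}. N i)" using \<open>0 < c\<close> by (simp add: N_def)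
  ultimately obtain n where n: "x n \<in> (\<Inter>i\<in>{..<k}. N i)"
    using closure unfolding in_closure_of by blast
  have "2/3 * c \<le> \<bar>inner (x n) (Y (n mod k))\<bar>"
    using Y[of "n div k" "n mod k"] by simp
  moreover have "inner (x n) (Y (n mod k)) \<in> {- (2/3 * c) <..< 2/3 * c}"
    using n \<open>k > 0\<close> by (simp add: N_def)
  ultimately show False by auto
qed

section \<open>Log-convex sequences\<close>

text \<open>A smaller constant absorbs the finitely many terms before index \<open>N\<close>; this is where they
  have to be nonzero.\<close>

lemma geometric_growth_of_eventual:
  fixes a :: "nat \<Rightarrow> real"
  assumes "\<And>n. 0 < a n" "1 < r" "0 < c" and "\<And>n. c * r ^ n \<le> a (n + N)"
  shows "\<exists>c>0. \<forall>n. c * r ^ n \<le> a n"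
  using assms
proof (induction N arbitrary: c)
  case 0
  then show ?case by auto
next
  case (Suc N)
  define d where "d = min (a N) (c / r)"
  have "d > 0" using Suc.prems by (simp add: d_def)
  moreover have "d * r ^ n \<le> a (n + N)" for n
  proof (cases n)
    case 0
    then show ?thesis by (simp add: d_def)
  next
    case (Suc m)
    have "d * r ^ n \<le> c / r * r ^ n"
      using Suc.prems(2) by (intro mult_right_mono) (auto simp: d_def)
    also have "\<dots> = c * r ^ m" using Suc.prems(2) \<open>n = Suc m\<close> by simp
    also have "\<dots> \<le> a (n + N)" using Suc.prems(4)[of m] \<open>n = Suc m\<close> by simp
    finally show ?thesis .
  qed
  ultimately show ?case using Suc.IH Suc.prems(1,2) by blast
qed

text \<open>Successive ratios of a log-convex sequence increase, so one strict increase forces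
  geometric growth from there on.\<close>

lemma log_convex_geometric_growth:
  fixes a :: "nat \<Rightarrow> real"
  assumes nonneg: "\<And>n. 0 \<le> a n"
    and convex: "\<And>n. (a (Suc n))\<^sup>2 \<le> a n * a (Suc (Suc n))"
    and zero: "\<And>n. a n = 0 \<Longrightarrow> a (Suc n) = 0"
    and increase: "a N < a (Suc N)"
  shows "\<exists>c r. 0 < c \<and> 1 < r \<and> (\<forall>n. c * r ^ n \<le> a n)"
proof -
  have persist: "a (n + k) = 0" if "a n = 0" for n k
    using that by (induction k) (simp_all add: zero)
  have pos: "0 < a n" for n
  proof (rule ccontr)
    assume "\<not> 0 < a n"
    then have n: "a n = 0" using nonneg[of n] by simp
    have "a (Suc N) = 0"
    proof (cases "n \<le> Suc N")
      case True
      then show ?thesis using persist[OF n, of "Suc N - n"] by simp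
    next
      case False
      \<comment> \<open>zeros also propagate backwards: \<open>a (Suc m) = 0\<close> follows from \<open>a (Suc (Suc m)) = 0\<close>\<close>
      have "a (Suc m) = 0" if "a (Suc m + k) = 0" for m k
        using that
      proof (induction k)
        case (Suc k)
        have "(a (Suc (m + k)))\<^sup>2 \<le> a (m + k) * a (Suc (Suc (m + k)))" by (rule convex)
        then show ?case using Suc by simp
      qed simp
      then show ?thesis using n False by (metis less_imp_le_nat le_add_diff_inverse not_le)
    qed
    then show False using increase nonneg[of N] by simp
  qed
  define r where "r = a (Suc N) / a N"
  have r: "1 < r" using increase pos by (simp add: r_def)
  have ratio: "r * a (n + N) \<le> a (Suc (n + N))" for n
  proof (induction n)
    case 0
    then show ?case using pos[of N] by (simp add: r_def)
  next
    case (Suc n)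
    have "a (n + N) * (r * a (Suc (n + N))) \<le> (a (Suc (n + N)))\<^sup>2"
      using mult_right_mono[OF Suc.IH nonneg[of "Suc (n + N)"]]
      by (simp add: power2_eq_square mult_ac)
    also have "\<dots> \<le> a (n + N) * a (Suc (Suc (n + N)))" by (rule convex)
    finally show ?case using pos[of "n + N"] by simp
  qed
  have "a N * r ^ n \<le> a (n + N)" for n
  proof (induction n)
    case (Suc n)
    have "r * (a N * r ^ n) \<le> r * a (n + N)" using Suc r by (intro mult_left_mono) auto
    then show ?case using ratio[of n] by (simp add: mult_ac)
  qed simp
  then have "\<exists>c>0. \<forall>n. c * r ^ n \<le> a n"
    by (rule geometric_growth_of_eventual[OF pos r pos])
  with r show ?thesis by blast
qed

section \<open>Orbits of hyponormal operators\<close>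

lemma lambda_hyponormal_norm_cadjoint_le:
  fixes T :: "'a::complex_hilbert_space \<Rightarrow> 'a"
  assumes T: "bounded_clinear T" and l: "0 < l" "l \<le> 1" and hyp: "lambda_hyponormal l T"
  shows "norm (cadjoint T z) \<le> norm (T z)"
proof -
  have adj: "inner (T u) v = inner u (cadjoint T v)" for u v
    by (simp add: inner_eq_Re_cinner cinner_cadjoint[OF T])
  have "0 \<le> inner (cadjoint T (T z) - (1 / l) *\<^sub>R T (cadjoint T z)) z"
    using hyp unfolding lambda_hyponormal_def op_le_def op_positive_def
    by (simp add: inner_eq_Re_cinner complex_nonneg_Reals_iff)
  also have "\<dots> = (norm (T z))\<^sup>2 - (1 / l) * (norm (cadjoint T z))\<^sup>2"
    using adj[of z "T z"] adj[of "cadjoint T z" z]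
    by (simp add: inner_diff_left power2_norm_eq_inner inner_commute[of "cadjoint T (T z)" z])
  finally have "(1 / l) * (norm (cadjoint T z))\<^sup>2 \<le> (norm (T z))\<^sup>2" by simp
  moreover have "1 * (norm (cadjoint T z))\<^sup>2 \<le> (1 / l) * (norm (cadjoint T z))\<^sup>2"
    using l by (intro mult_right_mono) auto
  ultimately have "(norm (cadjoint T z))\<^sup>2 \<le> (norm (T z))\<^sup>2" by linarith
  then show ?thesis by (rule power2_le_imp_le) simp
qed

lemma lambda_hyponormal_norm_log_convex:
  fixes T :: "'a::complex_hilbert_space \<Rightarrow> 'a"
  assumes T: "bounded_clinear T" and l: "0 < l" "l \<le> 1" and hyp: "lambda_hyponormal l T"
  shows "(norm (T z))\<^sup>2 \<le> norm z * norm (T (T z))"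
proof -
  have "(norm (T z))\<^sup>2 = inner z (cadjoint T (T z))"
    by (simp add: power2_norm_eq_inner inner_eq_Re_cinner cinner_cadjoint[OF T])
  also have "\<dots> \<le> norm z * norm (cadjoint T (T z))" by (rule norm_cauchy_schwarz)
  also have "\<dots> \<le> norm z * norm (T (T z))"
    by (intro mult_left_mono lambda_hyponormal_norm_cadjoint_le[OF assms]) simp
  finally show ?thesis .
qed

text \<open>The zero space must be excluded: its only orbit is weakly dense.\<close>

lemma infinite_dim_ex_nonzero:
  assumes "infinite_dim TYPE('a::complex_vector)"
  shows "\<exists>v::'a. v \<noteq> 0"
proof (rule ccontr)
  interpret vector_space "scaleC :: complex \<Rightarrow> 'a \<Rightarrow> 'a" by (rule vector_space_scaleC)
  assume "\<not> ?thesis"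
  then have "span ({} :: 'a set) = UNIV" by (auto simp: span_empty)
  then show False using assms unfolding infinite_dim_def by blast
qed

theorem theorem2p4:
  fixes T :: "'a::complex_hilbert_space \<Rightarrow> 'a" and l :: real
  assumes "infinite_dim TYPE('a)"
    and "bounded_clinear T"
    and "0 < l" and "l \<le> 1"
    and "lambda_hyponormal l T"
  shows "\<not> weakly_hypercyclic T"
proof
  assume "weakly_hypercyclic T"
  then obtain x where dense: "weak_topology closure_of Orb T x = UNIV"
    unfolding weakly_hypercyclic_def by blast
  define a where "a n = norm ((T ^^ n) x)" for n
  have Orb: "Orb T x = range (\<lambda>n. (T ^^ n) x)" by (auto simp: Orb_def)
  have T0: "T 0 = 0"
    using assms(2) by (simp add: bounded_clinear_def linear_simps)
  show False
  proof (cases "\<exists>N. a N < a (Suc N)")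
    case True
    then obtain N where "a N < a (Suc N)" by blast
    then obtain c r where "0 < c" "1 < r" "\<And>n. c * r ^ n \<le> a n"
      using log_convex_geometric_growth[of a N] lambda_hyponormal_norm_log_convex[OF assms(2-5)]
      by (auto simp: a_def T0)
    then have "0 \<notin> weak_topology closure_of Orb T x"
      unfolding Orb a_def by (rule geometric_growth_zero_not_in_weak_closure)
    then show False using dense by simp
  next
    case False
    then have "decseq a" by (simp add: decseq_Suc_iff not_less)
    then have "norm z \<le> a 0" if "z \<in> Orb T x" for z
    proof -
      obtain n where "z = (T ^^ n) x" using \<open>z \<in> Orb T x\<close> unfolding Orb by blast
      then show ?thesis using decseqD[OF \<open>decseq a\<close>, of 0 n] by (simp add: a_def)
    qed
    then show False
      using bounded_not_weakly_dense dense infinite_dim_ex_nonzero[OF assms(1)] by metis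
  qed
qed

end
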